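(* Let $H=(V,E)$ be a directed $m$-uniform hypergraph on $n$ vertices. Let $A_H=A_H^++A_H^-$, and let $A_{H_D}$ be the adjacency tensor of the underlying undirected hypergraph $H_D$ of $H$. Then $A_H$ and $A_{H_D}$ are isospectral.
   Context: $M_{m,n}$ is the set of real hypermatrices (tensors) $A=(a_{i_1i_2\dots i_m})$, $1\le i_1,\dots,i_m\le n$. For a vector $x$, $Ax^{m-1}$ is the vector with $i$-th entry $\sum_{i_2,\dots,i_m=1}^n a_{ii_2\dots i_m}x_{i_2}\cdots x_{i_m}$, and $x^{[m-1]}$ is the vector with $i$-th entry $x_i^{m-1}$. $\lambda\in\mathbb C$ is an eigenvalue of $A$ if $Ax^{m-1}=\lambda x^{[m-1]}$ for some $x\in\mathbb C^n\setminus\{0\}$. Two hypermatrices are isospectral if they have the same eigenvalues. A directed hypergraph $H=(V,E)$ has a finite vertex set $V=\{v_1,\dots,v_n\}$ and a set $E$ of edges; each edge $e$ is a subset of $V$ with a partition $e=T_e\sqcup H_e$ into a nonempty tail $T_e$ and a nonempty head $H_e$, and distinct edges $e_1\ne e_2$ satisfy $T_{e_1}\cup H_{e_1}\neq T_{e_2}\cup H_{e_2}$. It is $m$-uniform if $|e|=m$ for all $e\in E$. The underlying undirected hypergraph $H_D=(V,E_D)$ has edge set $E_D=\{T_e\cup H_e: e\in E\}$. For a directed $m$-uniform hypergraph: Out-adjacency hypermatrix $A_H^+=(a^+_{i_1\dots i_m})\in M_{m,n}$: for each edge $e$ with $|T_e|=k$, $a^+_{i_1\dots i_m}=\frac{1}{(m-k)!\,(k-1)!}$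 whenever $(v_{i_1},\dots,v_{i_k})$ is an ordering of all the elements of $T_e$ and $(v_{i_{k+1}},\dots,v_{i_m})$ is an ordering of all the elements of $H_e$; all other entries are $0$. In-adjacency hypermatrix $A_H^-=(a^-_{i_1\dots i_m})\in M_{m,n}$: for each edge $e$ with $|T_e|=k$, $a^-_{i_1\dots i_m}=\frac{1}{(m-k-1)!\,k!}$ whenever $(v_{i_1},\dots,v_{i_{m-k}})$ is an ordering of all the elements of $H_e$ and $(v_{i_{m-k+1}},\dots,v_{i_m})$ is an ordering of all the elements of $T_e$; all other entries are $0$. The adjacency tensor of an undirected $m$-uniform hypergraph on $\{v_1,\dots,v_n\}$ has $(i_1,\dots,i_m)$ entry $\frac1{(m-1)!}$ if $\{v_{i_1},\dots,v_{i_m}\}$ is an edge (with $i_1,\dots,i_m$ distinct), and $0$ otherwise. *)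

theory Defs
  imports "HOL-Analysis.Analysis" "HOL-Combinatorics.Multiset_Permutations"
begin

text \<open>
  A hypermatrix in \<open>M\<^sub>m\<^sub>,\<^sub>n\<close> is a function on index lists \<open>[i\<^sub>1, \<dots>, i\<^sub>m]\<close> over a finite index type
  with \<open>n\<close> elements. The order \<open>m\<close> is passed separately; only lists of length \<open>m\<close> matter.
\<close>

type_synonym 'n hypermatrix = "'n list \<Rightarrow> real"

definition hm_apply :: "nat \<Rightarrow> 'n::finite hypermatrix \<Rightarrow> complex ^ 'n \<Rightarrow> complex ^ 'n" where
  "hm_apply m A x =
     (\<chi> i. \<Sum>is | length is = m - 1. complex_of_real (A (i # is)) * (\<Prod>j\<leftarrow>is. x $ j))"

definition vec_power :: "complex ^ 'n::finite \<Rightarrow> nat \<Rightarrow> complex ^ 'n" where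
  "vec_power x r = (\<chi> i. (x $ i) ^ r)"

definition hm_eigenvalue :: "nat \<Rightarrow> 'n::finite hypermatrix \<Rightarrow> complex \<Rightarrow> bool" where
  "hm_eigenvalue m A l \<longleftrightarrow> (\<exists>x. x \<noteq> 0 \<and> hm_apply m A x = l *s vec_power x (m - 1))"

definition isospectral :: "nat \<Rightarrow> 'n::finite hypermatrix \<Rightarrow> 'n hypermatrix \<Rightarrow> bool" where
  "isospectral m A B \<longleftrightarrow> {l. hm_eigenvalue m A l} = {l. hm_eigenvalue m B l}"

text \<open>A directed edge is the pair of its tail and its head; its vertex set is their union.\<close>

type_synonym 'v dedge = "'v set \<times> 'v set"

abbreviation tail :: "'v dedge \<Rightarrow> 'v set" where "tail \<equiv> fst"
abbreviation head :: "'v dedge \<Rightarrow> 'v set" where "head \<equiv> snd"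

locale directed_hypergraph =
  fixes V :: "'v set" and E :: "'v dedge set"
  assumes finite_V: "finite V"
    and edge_subset: "e \<in> E \<Longrightarrow> tail e \<union> head e \<subseteq> V"
    and edge_disjoint: "e \<in> E \<Longrightarrow> tail e \<inter> head e = {}"
    and tail_nonempty: "e \<in> E \<Longrightarrow> tail e \<noteq> {}"
    and head_nonempty: "e \<in> E \<Longrightarrow> head e \<noteq> {}"
    and edges_distinct:
      "e1 \<in> E \<Longrightarrow> e2 \<in> E \<Longrightarrow> e1 \<noteq> e2 \<Longrightarrow> tail e1 \<union> head e1 \<noteq> tail e2 \<union> head e2"

locale uniform_directed_hypergraph = directed_hypergraph V E
  for m :: nat and V :: "'v set" and E :: "'v dedge set" +
  assumes uniform: "e \<in> E \<Longrightarrow> card (tail e \<union> head e) = m"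

definition underlying_edges :: "'v dedge set \<Rightarrow> 'v set set" where
  "underlying_edges E = {tail e \<union> head e | e. e \<in> E}"

text \<open>
  Throughout, \<open>v\<close> enumerates the vertices by the index type. Distinct edges have distinct vertex
  sets, so at most one edge contributes to each sum below: the lemmas after the definitions show
  that the sums describe the intended entries.
\<close>

definition out_ordered :: "('n \<Rightarrow> 'v) \<Rightarrow> 'v dedge \<Rightarrow> 'n list \<Rightarrow> bool" where
  "out_ordered v e is \<longleftrightarrow>
     map v (take (card (tail e)) is) \<in> permutations_of_set (tail e) \<and>
     map v (drop (card (tail e)) is) \<in> permutations_of_set (head e)"

definition in_ordered :: "nat \<Rightarrow> ('n \<Rightarrow> 'v) \<Rightarrow> 'v dedge \<Rightarrow> 'n list \<Rightarrow> bool" where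
  "in_ordered m v e is \<longleftrightarrow>
     map v (take (m - card (tail e)) is) \<in> permutations_of_set (head e) \<and>
     map v (drop (m - card (tail e)) is) \<in> permutations_of_set (tail e)"

definition out_adjacency :: "nat \<Rightarrow> ('n \<Rightarrow> 'v) \<Rightarrow> 'v dedge set \<Rightarrow> 'n hypermatrix" where
  "out_adjacency m v E is =
     (\<Sum>e | e \<in> E \<and> out_ordered v e is. 1 / (fact (m - card (tail e)) * fact (card (tail e) - 1)))"

definition in_adjacency :: "nat \<Rightarrow> ('n \<Rightarrow> 'v) \<Rightarrow> 'v dedge set \<Rightarrow> 'n hypermatrix" where
  "in_adjacency m v E is =
     (\<Sum>e | e \<in> E \<and> in_ordered m v e is. 1 / (fact (m - card (tail e) - 1) * fact (card (tail e))))"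

definition adjacency :: "nat \<Rightarrow> ('n \<Rightarrow> 'v) \<Rightarrow> 'v set set \<Rightarrow> 'n hypermatrix" where
  "adjacency m v ED is = (if distinct is \<and> v ` set is \<in> ED then 1 / fact (m - 1) else 0)"

lemma out_ordered_vertices:
  assumes "out_ordered v e is"
  shows "v ` set is = tail e \<union> head e"
proof -
  have "set is = set (take (card (tail e)) is) \<union> set (drop (card (tail e)) is)"
    by (metis append_take_drop_id set_append)
  then show ?thesis
    using assms by (auto simp: out_ordered_def permutations_of_set_def)
qed

lemma in_ordered_vertices:
  assumes "in_ordered m v e is"
  shows "v ` set is = tail e \<union> head e"
proof -
  have "set is = set (take (m - card (tail e)) is) \<union> set (drop (m - card (tail e)) is)"
    by (metis append_take_drop_id set_append)
  then show ?thesis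
    using assms by (auto simp: in_ordered_def permutations_of_set_def)
qed

context directed_hypergraph
begin

lemma out_adjacency_entry:
  assumes "e \<in> E" "out_ordered v e is" "card (tail e) = k"
  shows "out_adjacency m v E is = 1 / (fact (m - k) * fact (k - 1))"
proof -
  have "{e. e \<in> E \<and> out_ordered v e is} = {e}"
    using assms(1,2) edges_distinct out_ordered_vertices by blast
  then show ?thesis
    using assms(3) by (simp add: out_adjacency_def)
qed

lemma out_adjacency_zero:
  assumes "\<And>e. e \<in> E \<Longrightarrow> \<not> out_ordered v e is"
  shows "out_adjacency m v E is = 0"
proof -
  have "{e. e \<in> E \<and> out_ordered v e is} = {}"
    using assms by blast
  then show ?thesis
    by (simp only: out_adjacency_def sum.empty)
qed

lemma in_adjacency_entry:
  assumes "e \<in> E" "in_ordered m v e is" "card (tail e) = k"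
  shows "in_adjacency m v E is = 1 / (fact (m - k - 1) * fact k)"
proof -
  have "{e. e \<in> E \<and> in_ordered m v e is} = {e}"
    using assms(1,2) edges_distinct in_ordered_vertices by blast
  then show ?thesis
    using assms(3) by (simp add: in_adjacency_def)
qed

lemma in_adjacency_zero:
  assumes "\<And>e. e \<in> E \<Longrightarrow> \<not> in_ordered m v e is"
  shows "in_adjacency m v E is = 0"
proof -
  have "{e. e \<in> E \<and> in_ordered m v e is} = {}"
    using assms by blast
  then show ?thesis
    by (simp only: in_adjacency_def sum.empty)
qed

end

end

theory Submission
  imports Defs
begin

text \<open>
  The two hypermatrices differ, but they induce the same polynomial map \<open>x \<mapsto> Ax\<^sup>m\<^sup>-\<^sup>1\<close>, and the
  eigenvalue equation sees a hypermatrix only through this map. Each of the three adjacency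
  hypermatrices (out, in, undirected) is a sum over the edges \<open>e\<close> of a constant weight on the
  orderings of \<open>e\<close> of a certain kind. All orderings of \<open>e\<close> starting with \<open>i\<close> give the same monomial,
  the product of the \<open>x\<^sub>j\<close> over the vertices \<open>j \<noteq> i\<close> of \<open>e\<close>, so the coefficient of that monomial in
  the \<open>i\<close>-th component is the weight times the number of admissible orderings that start with \<open>i\<close>
  (\<open>hm_apply_edge_sum\<close>). The weights are normalised to make this coefficient an indicator: for the
  out-adjacency it is 1 if \<open>i\<close> lies in the tail and 0 otherwise, for the in-adjacency 1 if \<open>i\<close> lies
  in the head, for the undirected adjacency 1 if \<open>i\<close> lies in \<open>e\<close>. Since tail and head partition \<open>e\<close>,
  the first two indicators add up to the third.
\<close>

section \<open>Counting orderings with a prescribed first element\<close>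

lemma permutations_of_set_map_iff:
  assumes "inj v" "T \<subseteq> range v"
  shows "map v xs \<in> permutations_of_set T \<longleftrightarrow> xs \<in> permutations_of_set (v -` T)"
proof -
  have "v ` set xs = T \<longleftrightarrow> set xs = v -` T"
    using assms by (metis image_vimage_eq inf.absorb1 inj_vimage_image_eq)
  then show ?thesis
    using assms(1) by (auto simp: permutations_of_set_def distinct_map inj_on_def)
qed

lemma Cons_in_permutations_of_set_iff:
  "x # xs \<in> permutations_of_set A \<longleftrightarrow> x \<in> A \<and> xs \<in> permutations_of_set (A - {x})"
  by (auto simp: permutations_of_set_def)

lemma take_drop_in_permutations_of_set_Un:
  assumes "A \<inter> B = {}" "take k is \<in> permutations_of_set A" "drop k is \<in> permutations_of_set B"
  shows "is \<in> permutations_of_set (A \<union> B)"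
proof -
  have "take k is @ drop k is \<in> permutations_of_set (A \<union> B)"
    using assms unfolding permutations_of_set_def by (simp del: append_take_drop_id)
  then show ?thesis
    by simp
qed

lemma card_permutations_with_head:
  assumes "finite A"
  shows "card {xs. x # xs \<in> permutations_of_set A} = (if x \<in> A then fact (card A - 1) else 0)"
  using assms by (simp add: Cons_in_permutations_of_set_iff)

text \<open>
  Once \<open>x\<close> is removed, what remains is a permutation of \<open>A - {x}\<close> followed by one of \<open>B\<close>, and the
  length of the first part is fixed, so concatenation is a bijection from pairs of permutations.
  The lemma serves both directions of an edge: tail before head for the out-adjacency, head before
  tail for the in-adjacency.
\<close>

lemma card_two_block_orderings_with_head:
  assumes "finite A" "finite B" "A \<noteq> {}"
  shows "card {xs. take (card A) (x # xs) \<in> permutations_of_set A \<and>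
                   drop (card A) (x # xs) \<in> permutations_of_set B} =
           (if x \<in> A then fact (card A - 1) * fact (card B) else 0)"
    (is "card ?S = _")
proof -
  obtain k where k: "card A = Suc k"
    using assms by (metis card_eq_0_iff not0_implies_Suc)
  show ?thesis
  proof (cases "x \<in> A")
    case True
    let ?P = "permutations_of_set (A - {x}) \<times> permutations_of_set B"
    have len: "length p = k" if "p \<in> permutations_of_set (A - {x})" for p
      using that assms(1) True k by (simp add: permutations_of_set_def flip: distinct_card)
    have "?S = (\<lambda>(p, q). p @ q) ` ?P"
    proof (intro equalityI subsetI)
      fix xs assume "xs \<in> ?S"
      then have "(take k xs, drop k xs) \<in> ?P"
        by (simp add: k Cons_in_permutations_of_set_iff)
      then show "xs \<in> (\<lambda>(p, q). p @ q) ` ?P"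
        by (metis (no_types, lifting) append_take_drop_id case_prod_conv image_eqI)
    qed (use True in \<open>auto simp: k Cons_in_permutations_of_set_iff len\<close>)
    moreover have "inj_on (\<lambda>(p, q). p @ q) ?P"
      by (rule inj_onI) (auto dest!: len simp: append_eq_append_conv)
    ultimately have "card ?S = card ?P"
      by (simp add: card_image)
    then show ?thesis
      using assms True by (simp add: card_cartesian_product)
  qed (simp add: k Cons_in_permutations_of_set_iff)
qed

section \<open>Hypermatrices given by weighted orderings of edges\<close>

text \<open>
  The product over an index list depends only on the set of its entries when these are distinct, so
  all admissible lists of one edge contribute the same monomial and only their number matters. The
  weights are assumed to cancel this number, which leaves a 0/1 coefficient for each edge.
\<close>

lemma hm_apply_edge_sum:
  fixes S :: "'e \<Rightarrow> 'n::finite set" and w :: "'e \<Rightarrow> real"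
  assumes "finite E"
    and A: "\<And>is. A is = (\<Sum>e | e \<in> E \<and> P e is. w e)"
    and P: "\<And>e is. e \<in> E \<Longrightarrow> P e is \<Longrightarrow> is \<in> permutations_of_set (S e)"
    and m: "\<And>e. e \<in> E \<Longrightarrow> card (S e) = m"
    and Q: "\<And>e. e \<in> E \<Longrightarrow> w e * card {is. P e (i # is)} = of_bool (Q e)"
  shows "hm_apply m A x $ i = (\<Sum>e\<in>E. of_bool (Q e) * (\<Prod>j\<in>S e - {i}. x $ j))"
proof -
  let ?L = "{is :: 'n list. length is = m - 1}"
  have fin: "finite ?L"
    using finite_lists_length_eq[of "UNIV :: 'n set" "m - 1"] by simp
  have inner: "(\<Sum>is\<in>?L. if P e (i # is) then of_real (w e) * (\<Prod>j\<leftarrow>is. x $ j) else 0) =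
      of_bool (Q e) * (\<Prod>j\<in>S e - {i}. x $ j)" if e: "e \<in> E" for e
  proof -
    have perm: "is \<in> permutations_of_set (S e - {i})" "i \<in> S e" if "P e (i # is)" for "is"
      using P[OF e that] by (auto simp: Cons_in_permutations_of_set_iff)
    have "length is = m - 1" if "P e (i # is)" for "is"
      using perm[OF that] m[OF e]
      by (metis card_Diff_singleton length_finite_permutations_of_set)
    then have "{is \<in> ?L. P e (i # is)} = {is. P e (i # is)}"
      by auto
    then have "(\<Sum>is\<in>?L. if P e (i # is) then of_real (w e) * (\<Prod>j\<leftarrow>is. x $ j) else 0) =
        (\<Sum>is | P e (i # is). of_real (w e) * (\<Prod>j\<leftarrow>is. x $ j))"
      using sum.inter_filter[OF fin, of "\<lambda>is. of_real (w e) * (\<Prod>j\<leftarrow>is. x $ j)"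
          "\<lambda>is. P e (i # is)"]
      by simp
    also have "\<dots> = (\<Sum>is | P e (i # is). of_real (w e) * (\<Prod>j\<in>S e - {i}. x $ j))"
    proof (rule sum.cong[OF refl])
      fix "is" assume "is \<in> {is. P e (i # is)}"
      then have "distinct is" "set is = S e - {i}"
        using perm(1)[of "is"] by (auto simp: permutations_of_set_def)
      then show "of_real (w e) * (\<Prod>j\<leftarrow>is. x $ j) = of_real (w e) * (\<Prod>j\<in>S e - {i}. x $ j)"
        by (metis prod.distinct_set_conv_list)
    qed
    also have "\<dots> = of_real (w e * card {is. P e (i # is)}) * (\<Prod>j\<in>S e - {i}. x $ j)"
      by simp
    finally show ?thesis
      by (simp only: Q[OF e]) (simp add: of_bool_def)
  qed
  have "hm_apply m A x $ i =
      (\<Sum>is\<in>?L. \<Sum>e\<in>E. if P e (i # is) then of_real (w e) * (\<Prod>j\<leftarrow>is. x $ j) else 0)"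
    using \<open>finite E\<close>
    by (auto simp: hm_apply_def A sum_distrib_right sum.inter_filter intro!: sum.cong)
  also have "\<dots> = (\<Sum>e\<in>E. \<Sum>is\<in>?L.
      if P e (i # is) then of_real (w e) * (\<Prod>j\<leftarrow>is. x $ j) else 0)"
    by (rule sum.swap)
  finally show ?thesis
    by (simp only: inner cong: sum.cong)
qed

lemma hm_apply_add:
  "hm_apply m (\<lambda>is. A is + B is) x = hm_apply m A x + hm_apply m B x"
  by (simp add: hm_apply_def vec_eq_iff distrib_right sum.distrib)

section \<open>The three adjacency hypermatrices\<close>

locale enumerated_uniform_hypergraph = uniform_directed_hypergraph m V E
  for m :: nat and V :: "'v set" and E :: "'v dedge set" +
  fixes v :: "'n::finite \<Rightarrow> 'v"
  assumes bij_v: "bij_betw v UNIV V"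
begin

abbreviation tail_idx :: "'v dedge \<Rightarrow> 'n set" where "tail_idx e \<equiv> v -` tail e"
abbreviation head_idx :: "'v dedge \<Rightarrow> 'n set" where "head_idx e \<equiv> v -` head e"

lemma inj_v: "inj v"
  using bij_v by (rule bij_betw_imp_inj_on)

lemma finite_E: "finite E"
proof (rule finite_subset)
  show "E \<subseteq> Pow V \<times> Pow V"
    using edge_subset by fastforce
qed (simp add: finite_V)

lemma edge_in_range:
  assumes "e \<in> E"
  shows "tail e \<subseteq> range v" "head e \<subseteq> range v"
  using edge_subset[OF assms] bij_v by (auto simp: bij_betw_def)

lemma card_tail_idx: "e \<in> E \<Longrightarrow> card (tail_idx e) = card (tail e)"
  by (simp add: card_vimage_inj edge_in_range inj_v)

lemma card_head_idx: "e \<in> E \<Longrightarrow> card (head_idx e) = card (head e)"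
  by (simp add: card_vimage_inj edge_in_range inj_v)

lemma idx_disjoint: "e \<in> E \<Longrightarrow> tail_idx e \<inter> head_idx e = {}"
  using edge_disjoint by fastforce

lemma card_idx: "e \<in> E \<Longrightarrow> card (tail_idx e \<union> head_idx e) = m"
  using uniform[of e] edge_in_range[of e] inj_v
  by (simp add: card_vimage_inj flip: vimage_Un)

lemma card_head_eq:
  assumes "e \<in> E"
  shows "card (head e) = m - card (tail e)"
  using card_idx[OF assms] idx_disjoint[OF assms] card_tail_idx[OF assms] card_head_idx[OF assms]
  by (simp add: card_Un_disjoint)

lemma idx_nonempty:
  assumes "e \<in> E"
  shows "tail_idx e \<noteq> {}" "head_idx e \<noteq> {}"
  using edge_in_range[OF assms] tail_nonempty[OF assms] head_nonempty[OF assms] by blast+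

lemma out_ordered_iff:
  assumes "e \<in> E"
  shows "out_ordered v e is \<longleftrightarrow>
    take (card (tail_idx e)) is \<in> permutations_of_set (tail_idx e) \<and>
    drop (card (tail_idx e)) is \<in> permutations_of_set (head_idx e)"
  using assms
  by (simp add: out_ordered_def permutations_of_set_map_iff inj_v edge_in_range card_tail_idx)

lemma in_ordered_iff:
  assumes "e \<in> E"
  shows "in_ordered m v e is \<longleftrightarrow>
    take (card (head_idx e)) is \<in> permutations_of_set (head_idx e) \<and>
    drop (card (head_idx e)) is \<in> permutations_of_set (tail_idx e)"
  using assms
  by (simp add: in_ordered_def permutations_of_set_map_iff inj_v edge_in_range card_head_idx
      card_head_eq)

lemma hm_apply_out_adjacency:
  "hm_apply m (out_adjacency m v E) x $ i =
     (\<Sum>e\<in>E. of_bool (i \<in> tail_idx e) * (\<Prod>j\<in>tail_idx e \<union> head_idx e - {i}. x $ j))"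
proof -
  let ?w = "\<lambda>e. 1 / (fact (m - card (tail e)) * fact (card (tail e) - 1)) :: real"
  have "?w e * card {is. out_ordered v e (i # is)} = of_bool (i \<in> tail_idx e)" if "e \<in> E" for e
    using card_two_block_orderings_with_head[of "tail_idx e" "head_idx e" i] that
    by (simp add: out_ordered_iff idx_nonempty card_tail_idx card_head_idx card_head_eq)
  moreover have "is \<in> permutations_of_set (tail_idx e \<union> head_idx e)"
    if "e \<in> E" "out_ordered v e is" for e "is"
    using that take_drop_in_permutations_of_set_Un[OF idx_disjoint] out_ordered_iff by blast
  ultimately show ?thesis
    by (intro hm_apply_edge_sum[OF finite_E out_adjacency_def]) (simp_all only: card_idx)
qed

lemma hm_apply_in_adjacency:
  "hm_apply m (in_adjacency m v E) x $ i =
     (\<Sum>e\<in>E. of_bool (i \<in> head_idx e) * (\<Prod>j\<in>tail_idx e \<union> head_idx e - {i}. x $ j))"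
proof -
  let ?w = "\<lambda>e. 1 / (fact (m - card (tail e) - 1) * fact (card (tail e))) :: real"
  have "?w e * card {is. in_ordered m v e (i # is)} = of_bool (i \<in> head_idx e)" if "e \<in> E" for e
    using card_two_block_orderings_with_head[of "head_idx e" "tail_idx e" i] that
    by (simp add: in_ordered_iff idx_nonempty card_tail_idx card_head_idx card_head_eq)
  moreover have "is \<in> permutations_of_set (tail_idx e \<union> head_idx e)"
    if "e \<in> E" "in_ordered m v e is" for e "is"
    using that take_drop_in_permutations_of_set_Un[of "head_idx e" "tail_idx e"] idx_disjoint[of e]
      in_ordered_iff by (metis inf_commute sup_commute)
  ultimately show ?thesis
    by (intro hm_apply_edge_sum[OF finite_E in_adjacency_def]) (simp_all only: card_idx)
qed

text \<open>
  The case distinction in the undirected adjacency tensor is also a sum over edges, because distinct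
  edges have distinct vertex sets and so at most one edge matches a given list.
\<close>

lemma adjacency_eq_edge_sum:
  "adjacency m v (underlying_edges E) is =
     (\<Sum>e | e \<in> E \<and> is \<in> permutations_of_set (tail_idx e \<union> head_idx e). 1 / fact (m - 1))"
proof -
  have iff: "is \<in> permutations_of_set (tail_idx e \<union> head_idx e) \<longleftrightarrow>
      distinct is \<and> v ` set is = tail e \<union> head e" if "e \<in> E" for e
    using permutations_of_set_map_iff[OF inj_v, of "tail e \<union> head e" "is"] edge_in_range[OF that]
    by (auto simp: permutations_of_set_def distinct_map inj_on_subset[OF inj_v])
  show ?thesis
  proof (cases "\<exists>e\<in>E. is \<in> permutations_of_set (tail_idx e \<union> head_idx e)")
    case True
    then obtain e where e: "e \<in> E" "is \<in> permutations_of_set (tail_idx e \<union> head_idx e)"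
      by blast
    have "e' = e" if "e' \<in> E" "is \<in> permutations_of_set (tail_idx e' \<union> head_idx e')" for e'
      using edges_distinct[OF that(1) e(1)] iff[OF that(1)] iff[OF e(1)] that(2) e(2) by metis
    with e have "{e. e \<in> E \<and> is \<in> permutations_of_set (tail_idx e \<union> head_idx e)} = {e}"
      by blast
    moreover have "distinct is" "v ` set is \<in> underlying_edges E"
      using e iff[OF e(1)] unfolding underlying_edges_def by blast+
    ultimately show ?thesis
      by (simp add: adjacency_def)
  next
    case False
    then have "{e. e \<in> E \<and> is \<in> permutations_of_set (tail_idx e \<union> head_idx e)} = {}"
      by blast
    moreover have "\<not> (distinct is \<and> v ` set is \<in> underlying_edges E)"
      using False iff unfolding underlying_edges_def by blast
    ultimately show ?thesis
      by (simp only: adjacency_def sum.empty if_False)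
  qed
qed

lemma hm_apply_adjacency:
  "hm_apply m (adjacency m v (underlying_edges E)) x $ i =
     (\<Sum>e\<in>E. of_bool (i \<in> tail_idx e \<union> head_idx e) *
       (\<Prod>j\<in>tail_idx e \<union> head_idx e - {i}. x $ j))"
proof -
  have "1 / fact (m - 1) * card {is. i # is \<in> permutations_of_set (tail_idx e \<union> head_idx e)} =
      (of_bool (i \<in> tail_idx e \<union> head_idx e) :: real)" if "e \<in> E" for e
    using card_permutations_with_head[of "tail_idx e \<union> head_idx e" i] card_idx[OF that] by simp
  then show ?thesis
    by (intro hm_apply_edge_sum[OF finite_E adjacency_eq_edge_sum]) (simp_all only: card_idx)
qed

text \<open>Tail and head partition an edge, so the two indicators add up to that of the whole edge.\<close>

lemma hm_apply_out_plus_in: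
  "hm_apply m (\<lambda>is. out_adjacency m v E is + in_adjacency m v E is) x =
     hm_apply m (adjacency m v (underlying_edges E)) x"
proof -
  have "of_bool (i \<in> tail_idx e \<union> head_idx e) =
      (of_bool (i \<in> tail_idx e) + of_bool (i \<in> head_idx e) :: complex)" if "e \<in> E" for e i
    using idx_disjoint[OF that] by (auto simp: of_bool_def)
  then show ?thesis
    by (simp only: vec_eq_iff hm_apply_add vector_add_component hm_apply_out_adjacency
        hm_apply_in_adjacency hm_apply_adjacency distrib_right sum.distrib cong: sum.cong) simp
qed

end

section \<open>Isospectrality\<close>

theorem theorem7:
  fixes m :: nat and V :: "'v set" and E :: "'v dedge set" and v :: "'n::finite \<Rightarrow> 'v"
  assumes "uniform_directed_hypergraph m V E"
    and "bij_betw v UNIV V"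
  shows "isospectral m
           (\<lambda>is. out_adjacency m v E is + in_adjacency m v E is)
           (adjacency m v (underlying_edges E))"
proof -
  interpret enumerated_uniform_hypergraph m V E v
    using assms by (simp add: enumerated_uniform_hypergraph_def
        enumerated_uniform_hypergraph_axioms_def)
  show ?thesis
    by (simp add: isospectral_def hm_eigenvalue_def hm_apply_out_plus_in)
qed

end
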